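(* Let $\mathcal{F},\mathcal{M},\Phi,X,\mathcal{X},\mathcal{A},G,\epsilon$ be as in the context, and assume that $$\Phi(0;\mu)\ge 0\quad\forall \mu\in\mathcal{M}.$$ Then for every $f\in\mathcal{E}_F$ $$\widehat{\Psi}_+(f):=\inf_{\alpha}\left\{\Psi_+(f,\alpha)+\alpha\ln(2/\epsilon):\alpha>0,(f,\alpha)\in\mathcal{F}^+\right\}=\max_{x\in\mathcal{X}}\ \inf_{\alpha>0,(f,\alpha)\in\mathcal{F}^+}\left[\alpha\Phi(f/\alpha;\mathcal{A}(x))-G(x)+\alpha\ln(2/\epsilon)\right],$$ $$\widehat{\Psi}_-(f):=\inf_{\alpha}\left\{\Psi_-(f,\alpha)+\alpha\ln(2/\epsilon):\alpha>0,(f,\alpha)\in\mathcal{F}^+\right\}=\max_{x\in\mathcal{X}}\ \inf_{\alpha>0,(f,\alpha)\in\mathcal{F}^+}\left[\alpha\Phi(-f/\alpha;\mathcal{A}(x))+G(x)+\alpha\ln(2/\epsilon)\right],$$ and the functions $\widehat{\Psi}_\pm:\mathcal{E}_F\to\mathbf{R}$ are real-valued and convex. Furthermore, every feasible solution $(\bar f,\bar\varkappa,\bar\rho)$ to the system of convex constraints $$\widehat{\Psi}_+(f)\le\rho-\varkappa,\qquad \widehat{\Psi}_-(f)\le\rho+\varkappa$$ in variables $f\in\mathcal{E}_F$, $\rho\in\mathbf{R}$, $\varkappa\in\mathbf{R}$ induces the estimate $\widehat g(\omega)=\langle\bar f,\omega\rangle+\bar\varkappa$ of $G(x)$, $x\in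 X$, whose $\epsilon$-risk is at most $\bar\rho$: for every $x\in X$ and every Borel probability distribution $P$ on $\mathcal{E}_F$ associated with $x$, $$\mathrm{Prob}_{\omega\sim P}\{|\widehat g(\omega)-G(x)|>\bar\rho\}\le\epsilon.$$ The constraints $\widehat{\Psi}_+(\bar f)\le\bar\rho-\bar\varkappa$ and $\widehat{\Psi}_-(\bar f)\le\bar\rho+\bar\varkappa$ are satisfied when $\bar f\in\mathcal{E}_F$ is arbitrary and $$\bar\rho=\widehat\Psi(\bar f):=\tfrac12\left[\widehat{\Psi}_+(\bar f)+\widehat{\Psi}_-(\bar f)\right],\qquad \bar\varkappa=\tfrac12\left[\widehat{\Psi}_-(\bar f)-\widehat{\Psi}_+(\bar f)\right].$$ As a result, setting $\mathrm{Opt}=\inf_{f\in\mathcal{E}_F}\widehat\Psi(f)$, by properly selecting $\bar f$ one can make the upper bound $\widehat\Psi(\bar f)$ on the $\epsilon$-risk of the resulting estimate arbitrarily close to $\mathrm{Opt}$, and equal to $\mathrm{Opt}$ when the problem $\min_f\widehat\Psi(f)$ is solvable.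
   Context: Setting. $\mathcal{E}_F,\mathcal{E}_M,\mathcal{E}_X$ are Euclidean spaces; $\langle\cdot,\cdot\rangle$ denotes the inner product in the relevant space. Regular data: $\mathcal{F}\subset\mathcal{E}_F$ is a closed convex set, symmetric with respect to the origin, with $0\in\mathrm{int}\,\mathcal{F}$; $\mathcal{M}\subset\mathcal{E}_M$ is a closed convex set; $\Phi(h;\mu):\mathcal{F}\times\mathcal{M}\to\mathbf{R}$ is a continuous function, convex in $h\in\mathcal{F}$ and concave in $\mu\in\mathcal{M}$. Further data: a nonempty set $X$ contained in a convex compact set $\mathcal{X}\subset\mathcal{E}_X$; an affine mapping $\mathcal{A}:\mathcal{E}_X\to\mathcal{E}_M$ with $\mathcal{A}(\mathcal{X})\subset\mathcal{M}$; an affine function $G(x)=\langle g,x\rangle+c$ on $\mathcal{E}_X$ ($g\in\mathcal{E}_X$, $c\in\mathbf{R}$); a tolerance $\epsilon\in(0,1)$. Association: a Borel probability distribution $P$ on $\mathcal{E}_F$ is associated with $x\in X$ if $$\ln\left(\int_{\mathcal{E}_F}e^{\langle f,\omega\rangle}P(d\omega)\right)\le\Phi(f;\mathcal{A}(x))\quad\forall f\in\mathcal{F}.$$ $\epsilon$-risk: for an estimate (Borel function) $\widehat g:\mathcal{E}_F\to\mathbf{R}$, its $\epsilon$-risk is the smallest $\rho$ such that $\mathrm{Prob}_{\omega\sim P}\{|\widehat g(\omega)-G(x)|>\rho\}\le\epsilon$ for all $x\in X$ and all $P$ associated with $x$. Notation: $\mathcal{F}^+=\{(f,\alpha):f\in\mathcal{E}_F,\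 \alpha>0,\ f/\alpha\in\mathcal{F}\}$, and for $(f,\alpha)\in\mathcal{F}^+$ $$\Psi_+(f,\alpha)=\sup_{x\in\mathcal{X}}\left[\alpha\Phi(f/\alpha;\mathcal{A}(x))-G(x)\right],\qquad \Psi_-(f,\alpha)=\sup_{x\in\mathcal{X}}\left[\alpha\Phi(-f/\alpha;\mathcal{A}(x))+G(x)\right].$$ *)

theory Defs
  imports "HOL-Probability.Probability"
begin

text \<open>
  \<open>\<Phi>\<close> is a total function here; only its values on \<open>F \<times> M\<close> are constrained or used.
\<close>

definition regular_data ::
  "'f::euclidean_space set \<Rightarrow> 'm::euclidean_space set \<Rightarrow> ('f \<Rightarrow> 'm \<Rightarrow> real) \<Rightarrow> bool" where
  "regular_data F M \<Phi> \<longleftrightarrow>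
     closed F \<and> convex F \<and> (\<forall>h\<in>F. - h \<in> F) \<and> 0 \<in> interior F \<and>
     closed M \<and> convex M \<and>
     continuous_on (F \<times> M) (\<lambda>(h, \<mu>). \<Phi> h \<mu>) \<and>
     (\<forall>\<mu>\<in>M. convex_on F (\<lambda>h. \<Phi> h \<mu>)) \<and>
     (\<forall>h\<in>F. concave_on M (\<lambda>\<mu>. \<Phi> h \<mu>))"

definition affine_mapping :: "('x::real_vector \<Rightarrow> 'm::real_vector) \<Rightarrow> bool" where
  "affine_mapping A \<longleftrightarrow> (\<exists>L b. linear L \<and> (\<forall>x. A x = L x + b))"

text \<open>
  The Bochner integral of a non-integrable function is 0, so finiteness of the exponential
  moment, implicit in the inequality \<open>ln (\<integral> \<dots>) \<le> \<Phi> (f; A x) < \<infinity>\<close>, is required explicitly.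
\<close>

definition associated ::
  "'f::euclidean_space set \<Rightarrow> ('f \<Rightarrow> 'm \<Rightarrow> real) \<Rightarrow> ('x \<Rightarrow> 'm) \<Rightarrow> 'x \<Rightarrow> 'f measure \<Rightarrow> bool" where
  "associated F \<Phi> A x P \<longleftrightarrow>
     prob_space P \<and> sets P = sets borel \<and>
     (\<forall>f\<in>F. integrable P (\<lambda>\<omega>. exp (f \<bullet> \<omega>)) \<and>
             ln (LINT \<omega>|P. exp (f \<bullet> \<omega>)) \<le> \<Phi> f (A x))"

text \<open>
  The tail probability is right-continuous in \<open>\<rho>\<close>, so the infimum is the smallest admissible
  \<open>\<rho>\<close> whenever it is finite. It is \<open>\<infinity>\<close> if no \<open>\<rho>\<close> is admissible, and \<open>-\<infinity>\<close>
  only if no distribution is associated with any point of \<open>X\<close>.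
\<close>

definition eps_risk ::
  "'f::euclidean_space set \<Rightarrow> ('f \<Rightarrow> 'm \<Rightarrow> real) \<Rightarrow> 'x set \<Rightarrow> ('x \<Rightarrow> 'm) \<Rightarrow> ('x \<Rightarrow> real) \<Rightarrow>
   real \<Rightarrow> ('f \<Rightarrow> real) \<Rightarrow> ereal" where
  "eps_risk F \<Phi> X A G \<epsilon> ghat =
     (INF \<rho>\<in>{\<rho>::real. \<forall>x\<in>X. \<forall>P. associated F \<Phi> A x P \<longrightarrow>
                       \<P>(\<omega> in P. \<bar>ghat \<omega> - G x\<bar> > \<rho>) \<le> \<epsilon>}. ereal \<rho>)"

definition F_plus :: "'f::real_vector set \<Rightarrow> ('f \<times> real) set" where
  "F_plus F = {(f, \<alpha>). \<alpha> > 0 \<and> f /\<^sub>R \<alpha> \<in> F}"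

text \<open>
  Suprema and infima are taken in the extended reals, so that finiteness is part of
  what is to be shown rather than an artefact of \<open>Sup\<close> and \<open>Inf\<close> on \<open>real\<close>.
  The set \<open>XX\<close> is the convex compact set containing the signal set \<open>X\<close>.
\<close>

definition Psi_plus ::
  "('f::real_vector \<Rightarrow> 'm \<Rightarrow> real) \<Rightarrow> 'x set \<Rightarrow> ('x \<Rightarrow> 'm) \<Rightarrow> ('x \<Rightarrow> real) \<Rightarrow> 'f \<Rightarrow> real \<Rightarrow> ereal" where
  "Psi_plus \<Phi> XX A G f \<alpha> = (SUP x\<in>XX. ereal (\<alpha> * \<Phi> (f /\<^sub>R \<alpha>) (A x) - G x))"

definition Psi_minus ::
  "('f::real_vector \<Rightarrow> 'm \<Rightarrow> real) \<Rightarrow> 'x set \<Rightarrow> ('x \<Rightarrow> 'm) \<Rightarrow> ('x \<Rightarrow> real) \<Rightarrow> 'f \<Rightarrow> real \<Rightarrow> ereal" where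
  "Psi_minus \<Phi> XX A G f \<alpha> = (SUP x\<in>XX. ereal (\<alpha> * \<Phi> ((- f) /\<^sub>R \<alpha>) (A x) + G x))"

definition Psi_plus_hat ::
  "'f::real_vector set \<Rightarrow> ('f \<Rightarrow> 'm \<Rightarrow> real) \<Rightarrow> 'x set \<Rightarrow> ('x \<Rightarrow> 'm) \<Rightarrow> ('x \<Rightarrow> real) \<Rightarrow>
   real \<Rightarrow> 'f \<Rightarrow> ereal" where
  "Psi_plus_hat F \<Phi> XX A G \<epsilon> f =
     (INF \<alpha>\<in>{\<alpha>. \<alpha> > 0 \<and> (f, \<alpha>) \<in> F_plus F}. Psi_plus \<Phi> XX A G f \<alpha> + ereal (\<alpha> * ln (2 / \<epsilon>)))"

definition Psi_minus_hat ::
  "'f::real_vector set \<Rightarrow> ('f \<Rightarrow> 'm \<Rightarrow> real) \<Rightarrow> 'x set \<Rightarrow> ('x \<Rightarrow> 'm) \<Rightarrow> ('x \<Rightarrow> real) \<Rightarrow>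
   real \<Rightarrow> 'f \<Rightarrow> ereal" where
  "Psi_minus_hat F \<Phi> XX A G \<epsilon> f =
     (INF \<alpha>\<in>{\<alpha>. \<alpha> > 0 \<and> (f, \<alpha>) \<in> F_plus F}. Psi_minus \<Phi> XX A G f \<alpha> + ereal (\<alpha> * ln (2 / \<epsilon>)))"

definition Psi_hat ::
  "'f::real_vector set \<Rightarrow> ('f \<Rightarrow> 'm \<Rightarrow> real) \<Rightarrow> 'x set \<Rightarrow> ('x \<Rightarrow> 'm) \<Rightarrow> ('x \<Rightarrow> real) \<Rightarrow>
   real \<Rightarrow> 'f \<Rightarrow> ereal" where
  "Psi_hat F \<Phi> XX A G \<epsilon> f =
     (Psi_plus_hat F \<Phi> XX A G \<epsilon> f + Psi_minus_hat F \<Phi> XX A G \<epsilon> f) / 2"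

definition is_max_over :: "ereal \<Rightarrow> ('x \<Rightarrow> ereal) \<Rightarrow> 'x set \<Rightarrow> bool" where
  "is_max_over v h S \<longleftrightarrow> (\<exists>x\<in>S. h x = v) \<and> (\<forall>x\<in>S. h x \<le> v)"

end

theory Submission
  imports Defs
begin

text \<open>
  For a direction \<open>f\<close>, an admissible scale \<open>\<alpha>\<close> and a signal \<open>x\<close>, put
  \<open>B f \<alpha> x = \<alpha> \<Phi>(f / \<alpha>; A x) - G x + \<alpha> ln (2 / \<epsilon>)\<close>. The first term is a perspective, so \<open>B\<close> is
  jointly convex in \<open>(f, \<alpha>)\<close>; composing with the affine map \<open>A\<close> makes it concave and continuous
  in \<open>x\<close>. The function \<open>\<Psi>\<^sub>+\<close> hat is the infimum over \<open>\<alpha>\<close> of the supremum of \<open>B\<close> over \<open>x\<close>.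

  The exchange of infimum and maximum is a minimax theorem in which only the side of \<open>x\<close> is
  compact (\<open>compact_minimax\<close>). Convexity in \<open>f\<close> is the usual statement that minimising a jointly
  convex function over some of its variables leaves a convex function (\<open>upper_convex\<close>).
  The value is not \<open>\<infinity>\<close> because \<open>0\<close> is interior to \<open>F\<close>, which makes every large scale
  admissible, and \<open>B f \<alpha>\<close> is bounded on the compact signal set. It is not \<open>-\<infinity>\<close> because of
  \<open>\<Phi>(0; \<cdot>) \<ge> 0\<close>: the midpoint of \<open>f\<close> and \<open>-f\<close> is \<open>0\<close>, so convexity of the perspective bounds the
  bracket for \<open>(f, G)\<close> from below by minus the bracket for \<open>(-f, -G)\<close>
  (\<open>bracket_add_opposite_nonneg\<close>). The same inequality gives \<open>Opt \<ge> 0\<close>; so \<open>Opt\<close> is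
  finite, and for every \<open>\<delta> > 0\<close> some \<open>f\<close> comes within \<open>\<delta>\<close> of it.

  The risk bound is a Chernoff bound. If \<open>B f \<alpha> x \<le> r\<close> and \<open>P\<close> is associated with \<open>x\<close>, Markov's
  inequality for \<open>exp (f \<bullet> \<omega> / \<alpha>)\<close> gives probability at most \<open>\<epsilon> / 2\<close> to the event that
  \<open>f \<bullet> \<omega> - G x\<close> is at least \<open>r\<close>. The infimum over \<open>\<alpha>\<close> may not be attained, so this applies with
  \<open>r + \<eta>\<close> for each \<open>\<eta> > 0\<close>, and continuity of measure then removes \<open>\<eta>\<close> from the strict inequality
  (\<open>upper_tail_bound\<close>). The lower tail is the upper tail for \<open>-f\<close> and \<open>-G\<close>, and the two halves of
  \<open>\<epsilon>\<close> add up. By symmetry of \<open>F\<close>, \<open>\<Psi>\<^sub>-\<close> hat at \<open>f\<close> is \<open>\<Psi>\<^sub>+\<close> hat at \<open>-f\<close> with \<open>-G\<close> for \<open>G\<close>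
  (\<open>Psi_minus_hat_eq\<close>), so only the plus side is developed, with \<open>G\<close> left as a parameter.
\<close>

section \<open>A minimax theorem with one compact side\<close>

text \<open>
  The set of pairs dominated by some \<open>(u x, v x)\<close> is convex by concavity of \<open>u\<close> and \<open>v\<close>, and by
  hypothesis it misses a quadrant. A separating line has a nonnegative normal, whose
  normalised coordinates are the two weights.
\<close>
lemma two_function_minimax:
  fixes X :: "'x::euclidean_space set"
  assumes "convex X" "compact X"
    and u: "concave_on X u" "continuous_on X u"
    and v: "concave_on X v" "continuous_on X v"
    and less: "\<And>x. x \<in> X \<Longrightarrow> min (u x) (v x) < c"
  shows "\<exists>s t::real. s \<ge> 0 \<and> t \<ge> 0 \<and> s + t = 1 \<and> (\<forall>x\<in>X. s * u x + t * v x < c)"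
proof (cases "X = {}")
  case True
  then show ?thesis by (intro exI[of _ 1] exI[of _ 0]) auto
next
  case False
  have "continuous_on X (\<lambda>x. min (u x) (v x))"
    using u v by (intro continuous_intros)
  then obtain z where z: "z \<in> X" "\<And>x. x \<in> X \<Longrightarrow> min (u x) (v x) \<le> min (u z) (v z)"
    using continuous_attains_sup[OF \<open>compact X\<close> False] by blast
  \<comment> \<open>A level strictly between the attained maximum and \<open>c\<close> absorbs the loss of strictness
    in the separation.\<close>
  obtain d where d: "min (u z) (v z) < d" "d < c"
    using dense[OF less[OF z(1)]] by blast
  define S where "S = {p :: real \<times> real. \<exists>x\<in>X. fst p \<le> u x \<and> snd p \<le> v x}"
  define T where "T = {p :: real \<times> real. d \<le> fst p \<and> d \<le> snd p}"
  have "convex S"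
    unfolding convex_def
  proof (intro ballI allI impI)
    fix p q :: "real \<times> real" and s t :: real
    assume "p \<in> S" "q \<in> S" and st: "0 \<le> s" "0 \<le> t" "s + t = 1"
    then obtain x y where x: "x \<in> X" "fst p \<le> u x" "snd p \<le> v x"
      and y: "y \<in> X" "fst q \<le> u y" "snd q \<le> v y" by (auto simp: S_def)
    have "s * u x + t * u y \<le> u (s *\<^sub>R x + t *\<^sub>R y)"
      using u(1) x(1) y(1) st by (simp add: concave_on_iff)
    moreover have "s * v x + t * v y \<le> v (s *\<^sub>R x + t *\<^sub>R y)"
      using v(1) x(1) y(1) st by (simp add: concave_on_iff)
    moreover have "s * fst p + t * fst q \<le> s * u x + t * u y"
      "s * snd p + t * snd q \<le> s * v x + t * v y"
      using x y st by (auto intro!: add_mono mult_left_mono)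
    moreover have "s *\<^sub>R x + t *\<^sub>R y \<in> X"
      using \<open>convex X\<close> x(1) y(1) st by (simp add: convexD)
    ultimately show "s *\<^sub>R p + t *\<^sub>R q \<in> S"
      by (force simp: S_def)
  qed
  moreover have "convex T"
    unfolding convex_def
  proof (intro ballI allI impI)
    fix p q :: "real \<times> real" and s t :: real
    assume pq: "p \<in> T" "q \<in> T" and st: "0 \<le> s" "0 \<le> t" "s + t = 1"
    have d_eq: "s * d + t * d = d" using st by (metis distrib_right mult_1)
    have "s * d + t * d \<le> s * fst p + t * fst q" "s * d + t * d \<le> s * snd p + t * snd q"
      using pq st by (auto simp: T_def intro!: add_mono mult_left_mono)
    then show "s *\<^sub>R p + t *\<^sub>R q \<in> T" by (simp add: T_def d_eq)
  qed
  moreover have "S \<noteq> {}" 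
  proof -
    have "(u z, v z) \<in> S" using z(1) by (auto simp: S_def)
    then show ?thesis by blast
  qed
  moreover have "(d, d) \<in> T" by (simp add: T_def)
  moreover have "S \<inter> T = {}"
  proof -
    have False if p: "p \<in> S" "p \<in> T" for p
    proof -
      obtain x where "x \<in> X" "fst p \<le> u x" "snd p \<le> v x" using p by (auto simp: S_def)
      moreover from this have "d \<le> min (u x) (v x)" using p by (auto simp: T_def)
      ultimately show False using z(2)[of x] d by linarith
    qed
    then show ?thesis by blast
  qed
  ultimately obtain n e where n: "n \<noteq> (0 :: real \<times> real)"
    and S: "\<And>p. p \<in> S \<Longrightarrow> n \<bullet> p \<le> e" and T: "\<And>p. p \<in> T \<Longrightarrow> e \<le> n \<bullet> p"
    using separating_hyperplane_sets[of S T] by blast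
  define a b where "a = fst n" and "b = snd n"
  have T': "e \<le> a * (d + i) + b * (d + j)" if "i \<ge> 0" "j \<ge> 0" for i j
    using T[of "(d + i, d + j)"] that by (simp add: T_def a_def b_def inner_prod_def)
  \<comment> \<open>The half-plane contains the whole quadrant \<open>T\<close>, hence its normal is nonnegative.\<close>
  have nonneg: "w \<ge> 0" if w: "\<And>i. i \<ge> 0 \<Longrightarrow> e \<le> k + w * i" for w k :: real
  proof (rule ccontr)
    assume neg: "\<not> w \<ge> 0"
    define i where "i = (\<bar>k - e\<bar> + 1) / (- w)"
    have "i \<ge> 0" unfolding i_def using neg by (intro divide_nonneg_nonneg) auto
    moreover have "w * i = - (\<bar>k - e\<bar> + 1)" using neg by (simp add: i_def field_simps)
    ultimately show False using w[of i] by linarith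
  qed
  have "a \<ge> 0" using nonneg[of "a * d + b * d" a] T'[of _ 0] by (simp add: algebra_simps)
  have "b \<ge> 0" using nonneg[of "a * d + b * d" b] T'[of 0] by (simp add: algebra_simps)
  have "n = (a, b)" by (simp add: a_def b_def)
  then have "a \<noteq> 0 \<or> b \<noteq> 0" using n by (auto simp: zero_prod_def)
  then have pos: "a + b > 0" using \<open>a \<ge> 0\<close> \<open>b \<ge> 0\<close> by linarith
  have "a / (a + b) * u x + b / (a + b) * v x < c" if "x \<in> X" for x
  proof -
    have "(u x, v x) \<in> S" using that by (auto simp: S_def)
    then have "a * u x + b * v x \<le> e"
      using S[of "(u x, v x)"] by (simp add: a_def b_def inner_prod_def)
    also have "\<dots> \<le> (a + b) * d" using T'[of 0 0] by (simp add: algebra_simps)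
    finally have "(a * u x + b * v x) / (a + b) \<le> d"
      using pos by (simp add: field_simps)
    then show ?thesis using d by (simp add: add_divide_distrib)
  qed
  then show ?thesis
    using \<open>a \<ge> 0\<close> \<open>b \<ge> 0\<close> pos
    by (intro exI[of _ "a / (a + b)"] exI[of _ "b / (a + b)"])
      (auto simp: add_divide_distrib[symmetric])
qed

text \<open>
  Induction on the number of points, as in Komiya's elementary proof of Sion's theorem: two
  points can be replaced by one on the segment between them, so separation in the plane suffices
  whatever the number of points.
\<close>
lemma finite_minimax:
  fixes X :: "'x::euclidean_space set" and S :: "'a::real_vector set"
  assumes "finite I" "I \<noteq> {}" "I \<subseteq> S"
    and conv: "\<And>x. x \<in> X \<Longrightarrow> convex_on S (\<lambda>a. \<phi> a x)"
    and S: "convex S"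
    and conc: "\<And>a. a \<in> S \<Longrightarrow> concave_on X (\<phi> a)"
    and cont: "\<And>a. a \<in> S \<Longrightarrow> continuous_on X (\<phi> a)"
    and X: "convex X" "compact X"
    and less: "\<And>x. x \<in> X \<Longrightarrow> \<exists>a\<in>I. \<phi> a x < c"
  shows "\<exists>a\<in>S. \<forall>x\<in>X. \<phi> a x < c"
  using assms
proof (induction I arbitrary: X rule: finite_ne_induct)
  case (singleton a)
  have "a \<in> S" using singleton.prems(1) by simp
  moreover have "\<forall>x\<in>X. \<phi> a x < c" using singleton.prems(8) by simp
  ultimately show ?case by blast
next
  case (insert a I)
  \<comment> \<open>Where \<open>\<phi> a\<close> is already below \<open>c\<close> nothing is to be done; the rest is a smaller
    compact convex set, which the induction hypothesis serves with a single point.\<close>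
  define Y where "Y = {x \<in> X. c \<le> \<phi> a x}"
  have a: "a \<in> S" using insert.prems by simp
  have "compact Y"
  proof -
    have "closedin (top_of_set X) Y"
      unfolding Y_def
      using continuous_closedin_preimage[OF insert.prems(5)[OF a], of "{c..}"]
      by (simp add: vimage_def Int_def)
    then show ?thesis using insert.prems(7) closedin_compact by blast
  qed
  have "convex Y"
    unfolding convex_def
  proof (intro ballI allI impI)
    fix x y and s t :: real
    assume xy: "x \<in> Y" "y \<in> Y" and st: "0 \<le> s" "0 \<le> t" "s + t = 1"
    have "s * c + t * c \<le> s * \<phi> a x + t * \<phi> a y"
      using xy st by (auto simp: Y_def intro!: add_mono mult_left_mono)
    moreover have "s * c + t * c = c" using st by (metis distrib_right mult_1)
    moreover have "s * \<phi> a x + t * \<phi> a y \<le> \<phi> a (s *\<^sub>R x + t *\<^sub>R y)"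
      using insert.prems(4)[OF a] xy st by (simp add: concave_on_iff Y_def)
    moreover have "s *\<^sub>R x + t *\<^sub>R y \<in> X"
      using insert.prems(6) xy st by (simp add: convexD Y_def)
    ultimately show "s *\<^sub>R x + t *\<^sub>R y \<in> Y" by (simp add: Y_def)
  qed
  have "\<exists>b\<in>S. \<forall>x\<in>Y. \<phi> b x < c"
  proof (rule insert.IH)
    show "concave_on Y (\<phi> b)" if "b \<in> S" for b
      using insert.prems(4)[OF that] _ \<open>convex Y\<close>
      unfolding concave_on_def by (rule convex_on_subset) (auto simp: Y_def)
    show "continuous_on Y (\<phi> b)" if "b \<in> S" for b
      using insert.prems(5)[OF that] by (rule continuous_on_subset) (auto simp: Y_def)
    show "\<exists>b\<in>I. \<phi> b x < c" if "x \<in> Y" for x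
      using insert.prems(8)[of x] that by (auto simp: Y_def not_less[symmetric])
  qed (use insert.prems \<open>convex Y\<close> \<open>compact Y\<close> in \<open>auto simp: Y_def\<close>)
  then obtain b where b: "b \<in> S" "\<And>x. x \<in> Y \<Longrightarrow> \<phi> b x < c" by blast
  have "\<exists>s t::real. s \<ge> 0 \<and> t \<ge> 0 \<and> s + t = 1 \<and> (\<forall>x\<in>X. s * \<phi> a x + t * \<phi> b x < c)"
  proof (rule two_function_minimax)
    show "min (\<phi> a x) (\<phi> b x) < c" if "x \<in> X" for x
      using b(2)[of x] that unfolding Y_def min_less_iff_disj by (cases "\<phi> a x < c") auto
  qed (use insert.prems(4,5)[OF a] insert.prems(4,5)[OF b(1)] insert.prems(6,7) in auto)
  then obtain s t :: real where st: "s \<ge> 0" "t \<ge> 0" "s + t = 1"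
    and lt: "\<And>x. x \<in> X \<Longrightarrow> s * \<phi> a x + t * \<phi> b x < c" by blast
  have "\<phi> (s *\<^sub>R a + t *\<^sub>R b) x < c" if "x \<in> X" for x
  proof -
    have "\<phi> (s *\<^sub>R a + t *\<^sub>R b) x \<le> s * \<phi> a x + t * \<phi> b x"
      using insert.prems(2)[OF that] a b(1) st by (simp add: convex_on_def)
    then show ?thesis using lt[OF that] by linarith
  qed
  moreover have "s *\<^sub>R a + t *\<^sub>R b \<in> S" using insert.prems(3) a b(1) st by (simp add: convexD)
  ultimately show ?case by blast
qed

text \<open>
  If every \<open>x\<close> had an infimum strictly below the minimax value, compactness would reduce the
  witnesses to finitely many points and a common level below that value, and
  \<open>finite_minimax\<close> would merge these points into one that contradicts the definition of the
  value.
\<close>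
theorem compact_minimax:
  fixes X :: "'x::euclidean_space set" and S :: "'a::real_vector set"
  assumes conv: "\<And>x. x \<in> X \<Longrightarrow> convex_on S (\<lambda>a. \<phi> a x)"
    and S: "convex S"
    and conc: "\<And>a. a \<in> S \<Longrightarrow> concave_on X (\<phi> a)"
    and cont: "\<And>a. a \<in> S \<Longrightarrow> continuous_on X (\<phi> a)"
    and X: "convex X" "compact X" "X \<noteq> {}"
  shows "is_max_over (INF a\<in>S. SUP x\<in>X. ereal (\<phi> a x)) (\<lambda>x. INF a\<in>S. ereal (\<phi> a x)) X"
proof -
  define V where "V = (INF a\<in>S. SUP x\<in>X. ereal (\<phi> a x))"
  have weak: "(INF a\<in>S. ereal (\<phi> a x)) \<le> V" if "x \<in> X" for x
    unfolding V_def using that by (intro INF_mono) (auto intro: SUP_upper)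
  have "\<exists>x\<in>X. V \<le> (INF a\<in>S. ereal (\<phi> a x))"
  proof (rule ccontr)
    assume "\<not> ?thesis"
    then have below: "\<exists>a\<in>S. ereal (\<phi> a x) < V" if "x \<in> X" for x
      using that by (auto simp: not_le INF_less_iff)
    define J where "J = {(a, d). a \<in> S \<and> ereal d < V}"
    have "\<exists>U. open U \<and> {x \<in> X. \<phi> a x < d} = X \<inter> U" if "a \<in> S" for a d
      using continuous_openin_preimage_gen[OF cont[OF that], of "{..<d}"]
      by (auto simp: openin_open vimage_def Int_def)
    then obtain U where U: "\<And>a d. a \<in> S \<Longrightarrow> open (U a d)"
      "\<And>a d. a \<in> S \<Longrightarrow> {x \<in> X. \<phi> a x < d} = X \<inter> U a d"
      by metis
    have "X \<subseteq> (\<Union>j\<in>J. U (fst j) (snd j))"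
    proof
      fix x assume x: "x \<in> X"
      obtain a where a: "a \<in> S" "ereal (\<phi> a x) < V" using below[OF x] by blast
      obtain d where d: "ereal (\<phi> a x) < ereal d" "ereal d < V"
        using ereal_dense2[OF a(2)] by blast
      have "x \<in> U a d" using U(2)[OF a(1), of d] x d(1) by auto
      then show "x \<in> (\<Union>j\<in>J. U (fst j) (snd j))"
        using a(1) d(2) by (auto simp: J_def)
    qed
    then obtain K where K: "K \<subseteq> J" "finite K" "X \<subseteq> (\<Union>j\<in>K. U (fst j) (snd j))"
      by (rule compactE_image[OF X(2), rotated]) (auto simp: J_def U(1))
    have K_ne: "K \<noteq> {}" using K(3) X(3) by auto
    define d where "d = Max (snd ` K)"
    have "d \<in> snd ` K" using K(2) K_ne by (simp add: d_def)
    then have dV: "ereal d < V" using K(1) by (auto simp: J_def)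
    have "\<exists>a\<in>S. \<forall>x\<in>X. \<phi> a x < d"
    proof (rule finite_minimax[of "fst ` K"])
      show "\<exists>a\<in>fst ` K. \<phi> a x < d" if x: "x \<in> X" for x
      proof -
        obtain j where j: "j \<in> K" "x \<in> U (fst j) (snd j)" using K(3) x by blast
        have "fst j \<in> S" using j(1) K(1) by (auto simp: J_def)
        then have "\<phi> (fst j) x < snd j" using U(2) j(2) x by blast
        also have "snd j \<le> d" using j(1) K(2) by (simp add: d_def)
        finally show ?thesis using j(1) by blast
      qed
      show "fst ` K \<subseteq> S" using K(1) by (auto simp: J_def)
    qed (use K(2) K_ne conv conc cont S X in auto)
    then obtain a where "a \<in> S" "\<And>x. x \<in> X \<Longrightarrow> \<phi> a x < d" by blast
    then have "V \<le> ereal d"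
      unfolding V_def by (intro INF_lower2[of a] SUP_least) (auto intro: less_imp_le)
    then show False using dV by simp
  qed
  then show ?thesis
    using weak unfolding is_max_over_def V_def by (meson antisym)
qed

section \<open>Exponential tail bounds for associated distributions\<close>

text \<open>
  Chernoff's bound, solved for the threshold \<open>r\<close> at which Markov's inequality yields \<open>\<delta>\<close>.
\<close>
lemma exp_moment_tail_bound:
  fixes P :: "'f::euclidean_space measure"
  assumes "prob_space P" "sets P = sets borel" "0 < \<delta>"
    and int: "integrable P (\<lambda>\<omega>. exp (h \<bullet> \<omega>))"
    and le: "ln (LINT \<omega>|P. exp (h \<bullet> \<omega>)) + ln (1 / \<delta>) \<le> r"
  shows "\<P>(\<omega> in P. h \<bullet> \<omega> \<ge> r) \<le> \<delta>"
proof -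
  interpret prob_space P by fact
  have "(LINT \<omega>|P. exp (h \<bullet> \<omega>)) > 0"
    by (rule expectation_greater[OF int]) auto
  then have "(LINT \<omega>|P. exp (h \<bullet> \<omega>)) = exp (ln (LINT \<omega>|P. exp (h \<bullet> \<omega>)))" by simp
  also have "\<dots> \<le> exp (r - ln (1 / \<delta>))" using le by simp
  also have "\<dots> = exp r * \<delta>" using \<open>0 < \<delta>\<close> by (simp add: exp_diff)
  finally have "(LINT \<omega>|P. exp (h \<bullet> \<omega>)) / exp r \<le> \<delta>" by (simp add: field_simps)
  moreover have "\<P>(\<omega> in P. exp (h \<bullet> \<omega>) \<ge> exp r) \<le> (LINT \<omega>|P. exp (h \<bullet> \<omega>)) / exp r"
    using integral_Markov_inequality_measure[OF int, of "space P" "exp r"] by simp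
  ultimately show ?thesis by simp
qed

text \<open>
  An event with a strict inequality is the increasing union of the events in which the inequality
  holds with a positive margin.
\<close>
lemma (in prob_space) prob_greater_le_of_slack:
  assumes [measurable]: "Y \<in> borel_measurable M"
    and slack: "\<And>\<eta>::real. \<eta> > 0 \<Longrightarrow> \<P>(\<omega> in M. Y \<omega> \<ge> r + \<eta>) \<le> p"
  shows "\<P>(\<omega> in M. Y \<omega> > r) \<le> p"
proof -
  define E where "E n = {\<omega> \<in> space M. Y \<omega> \<ge> r + inverse (real (Suc n))}" for n
  have "(\<lambda>n. prob (E n)) \<longlonglongrightarrow> prob (\<Union>n. E n)"
  proof (rule finite_Lim_measure_incseq)
    show "incseq E"
    proof (rule incseq_SucI)
      fix n
      have "inverse (real (Suc (Suc n))) \<le> inverse (real (Suc n))"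
        by (intro le_imp_inverse_le) auto
      then show "E n \<subseteq> E (Suc n)" unfolding E_def by (smt (verit) mem_Collect_eq subsetI)
    qed
  qed (auto simp: E_def)
  moreover have "(\<Union>n. E n) = {\<omega> \<in> space M. Y \<omega> > r}"
  proof (intro set_eqI iffI)
    fix \<omega> assume "\<omega> \<in> {\<omega> \<in> space M. Y \<omega> > r}"
    moreover from this obtain n where "inverse (real (Suc n)) < Y \<omega> - r"
      using reals_Archimedean[of "Y \<omega> - r"] by auto
    ultimately show "\<omega> \<in> (\<Union>n. E n)" by (auto simp: E_def intro!: exI[of _ n])
  next
    fix \<omega> assume "\<omega> \<in> (\<Union>n. E n)"
    then obtain n where "\<omega> \<in> space M" "Y \<omega> \<ge> r + inverse (real (Suc n))" by (auto simp: E_def)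
    moreover have "inverse (real (Suc n)) > 0" by simp
    ultimately show "\<omega> \<in> {\<omega> \<in> space M. Y \<omega> > r}" by (auto simp del: inverse_positive_iff_positive)
  qed
  ultimately have "(\<lambda>n. prob (E n)) \<longlonglongrightarrow> \<P>(\<omega> in M. Y \<omega> > r)" by simp
  then show ?thesis
    by (rule LIMSEQ_le_const2) (auto simp: E_def intro!: slack)
qed

section \<open>The perspective function\<close>

text \<open>
  The combined argument \<open>(s u + t v) / \<gamma>\<close> is the convex combination of \<open>u / \<alpha>\<close> and \<open>v / \<beta>\<close> with
  the weights \<open>s \<alpha> / \<gamma>\<close> and \<open>t \<beta> / \<gamma>\<close>; multiplying Jensen's inequality by \<open>\<gamma>\<close> cancels the
  denominators.
\<close>
lemma perspective_convex:
  fixes h :: "'f::real_vector \<Rightarrow> real"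
  assumes h: "convex_on F h"
    and pos: "\<alpha> > 0" "\<beta> > 0" and F: "u /\<^sub>R \<alpha> \<in> F" "v /\<^sub>R \<beta> \<in> F"
    and st: "s \<ge> 0" "t \<ge> 0" "s + t = 1"
  defines "\<gamma> \<equiv> s * \<alpha> + t * \<beta>"
  shows "\<gamma> > 0" and "(s *\<^sub>R u + t *\<^sub>R v) /\<^sub>R \<gamma> \<in> F"
    and "\<gamma> * h ((s *\<^sub>R u + t *\<^sub>R v) /\<^sub>R \<gamma>) \<le> s * (\<alpha> * h (u /\<^sub>R \<alpha>)) + t * (\<beta> * h (v /\<^sub>R \<beta>))"
proof -
  show \<gamma>: "\<gamma> > 0"
  proof (cases "s = 0")
    case False
    then have "s * \<alpha> > 0" using st pos by simp
    then show ?thesis using st pos by (simp add: \<gamma>_def add_pos_nonneg)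
  qed (use st pos in \<open>simp add: \<gamma>_def\<close>)
  define a b where "a = s * \<alpha> / \<gamma>" and "b = t * \<beta> / \<gamma>"
  have ab: "a \<ge> 0" "b \<ge> 0" "a + b = 1"
    using st pos \<gamma> by (auto simp: a_def b_def add_divide_distrib[symmetric] \<gamma>_def)
  have eq: "(s *\<^sub>R u + t *\<^sub>R v) /\<^sub>R \<gamma> = a *\<^sub>R (u /\<^sub>R \<alpha>) + b *\<^sub>R (v /\<^sub>R \<beta>)"
    using pos \<gamma> by (simp add: a_def b_def scaleR_add_right divide_simps)
  show "(s *\<^sub>R u + t *\<^sub>R v) /\<^sub>R \<gamma> \<in> F"
    unfolding eq using h F ab by (intro convexD) (auto simp: convex_on_def)
  have "h ((s *\<^sub>R u + t *\<^sub>R v) /\<^sub>R \<gamma>) \<le> a * h (u /\<^sub>R \<alpha>) + b * h (v /\<^sub>R \<beta>)"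
    unfolding eq using h F ab unfolding convex_on_def by blast
  then have "\<gamma> * h ((s *\<^sub>R u + t *\<^sub>R v) /\<^sub>R \<gamma>) \<le> \<gamma> * (a * h (u /\<^sub>R \<alpha>) + b * h (v /\<^sub>R \<beta>))"
    using \<gamma> by (intro mult_left_mono) auto
  also have "\<dots> = s * (\<alpha> * h (u /\<^sub>R \<alpha>)) + t * (\<beta> * h (v /\<^sub>R \<beta>))"
    using \<gamma> by (simp add: a_def b_def field_simps)
  finally show "\<gamma> * h ((s *\<^sub>R u + t *\<^sub>R v) /\<^sub>R \<gamma>) \<le> s * (\<alpha> * h (u /\<^sub>R \<alpha>)) + t * (\<beta> * h (v /\<^sub>R \<beta>))" .
qed

section \<open>One-sided bounds\<close>

text \<open>
  The affine function \<open>G\<close> is not fixed here, because the theory is applied both to it and to \<open>-G\<close>.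
\<close>
locale estimation_data =
  fixes F :: "'f::euclidean_space set"
    and M :: "'m::euclidean_space set"
    and \<Phi> :: "'f \<Rightarrow> 'm \<Rightarrow> real"
    and XX :: "'x::euclidean_space set"
    and A :: "'x \<Rightarrow> 'm"
    and \<epsilon> :: real
  assumes regular: "regular_data F M \<Phi>"
    and XX: "XX \<noteq> {}" "convex XX" "compact XX"
    and A: "affine_mapping A" "A ` XX \<subseteq> M"
    and eps: "0 < \<epsilon>" "\<epsilon> < 1"
    and \<Phi>_0: "\<And>\<mu>. \<mu> \<in> M \<Longrightarrow> \<Phi> 0 \<mu> \<ge> 0"
begin

definition scales :: "'f \<Rightarrow> real set" where
  "scales f = {\<alpha>. \<alpha> > 0 \<and> (f, \<alpha>) \<in> F_plus F}"

definition bracket :: "('x \<Rightarrow> real) \<Rightarrow> 'f \<Rightarrow> real \<Rightarrow> 'x \<Rightarrow> real" where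
  "bracket G f \<alpha> x = \<alpha> * \<Phi> (f /\<^sub>R \<alpha>) (A x) - G x + \<alpha> * ln (2 / \<epsilon>)"

abbreviation upper :: "('x \<Rightarrow> real) \<Rightarrow> 'f \<Rightarrow> ereal" where
  "upper G \<equiv> Psi_plus_hat F \<Phi> XX A G \<epsilon>"

lemma mem_scales: "\<alpha> \<in> scales f \<longleftrightarrow> \<alpha> > 0 \<and> f /\<^sub>R \<alpha> \<in> F"
  by (auto simp: scales_def F_plus_def)

lemma scales_uminus [simp]: "scales (- f) = scales f"
proof -
  have "- (f /\<^sub>R \<alpha>) \<in> F \<longleftrightarrow> f /\<^sub>R \<alpha> \<in> F" for \<alpha>
    using regular minus_minus unfolding regular_data_def by metis
  then show ?thesis by (auto simp: mem_scales)
qed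

lemma scales_nonempty: "scales f \<noteq> {}"
proof -
  \<comment> \<open>Any \<open>\<alpha>\<close> larger than \<open>norm f / r\<close> brings \<open>f / \<alpha>\<close> into a ball of radius \<open>r\<close> inside \<open>F\<close>.\<close>
  obtain r where r: "r > 0" "ball 0 r \<subseteq> F"
    using regular by (auto simp: regular_data_def mem_interior)
  define \<alpha> where "\<alpha> = (norm f + 1) / r"
  have \<alpha>: "\<alpha> > 0" using r by (simp add: \<alpha>_def add_nonneg_pos)
  have "norm f < norm f + 1" by simp
  also have "\<dots> = r * \<alpha>" using r by (simp add: \<alpha>_def)
  finally have "norm (f /\<^sub>R \<alpha>) < r" using \<alpha> by (simp add: field_simps)
  then have "\<alpha> \<in> scales f" using \<alpha> r by (auto simp: mem_scales)
  then show ?thesis by blast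
qed

lemma A_combination: "s + t = 1 \<Longrightarrow> A (s *\<^sub>R x + t *\<^sub>R y) = s *\<^sub>R A x + t *\<^sub>R A y"
proof -
  assume "s + t = 1"
  moreover obtain L b where "linear L" "\<And>x. A x = L x + b"
    using A(1) by (auto simp: affine_mapping_def)
  ultimately show ?thesis
    by (simp add: linear_add linear_scale scaleR_add_right)
      (metis add.assoc add.commute scaleR_add_left scaleR_one)
qed

lemma continuous_on_A: "continuous_on S A"
proof -
  obtain L b where "linear L" "A = (\<lambda>x. L x + b)"
    using A(1) by (auto simp: affine_mapping_def)
  then show ?thesis
    by (simp add: linear_conv_bounded_linear linear_continuous_on continuous_on_add)
qed

lemma bracket_jointly_convex:
  assumes "x \<in> XX" "\<alpha> \<in> scales u" "\<beta> \<in> scales v" and st: "s \<ge> 0" "t \<ge> 0" "s + t = 1"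
  shows "s * \<alpha> + t * \<beta> \<in> scales (s *\<^sub>R u + t *\<^sub>R v)"
    and "bracket G (s *\<^sub>R u + t *\<^sub>R v) (s * \<alpha> + t * \<beta>) x
      \<le> s * bracket G u \<alpha> x + t * bracket G v \<beta> x"
proof -
  have "convex_on F (\<lambda>h. \<Phi> h (A x))"
    using regular A(2) assms(1) by (auto simp: regular_data_def)
  note persp = perspective_convex[OF this, of \<alpha> \<beta> u v s t]
  show "s * \<alpha> + t * \<beta> \<in> scales (s *\<^sub>R u + t *\<^sub>R v)"
    using assms persp by (simp add: mem_scales)
  have "G x = s * G x + t * G x" using st by (metis distrib_right mult_1)
  then show "bracket G (s *\<^sub>R u + t *\<^sub>R v) (s * \<alpha> + t * \<beta>) x
      \<le> s * bracket G u \<alpha> x + t * bracket G v \<beta> x"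
    using assms persp(3) by (simp add: bracket_def mem_scales algebra_simps)
qed

lemma bracket_concave_continuous:
  assumes \<alpha>: "\<alpha> \<in> scales f"
  shows "concave_on XX (bracket (\<lambda>x. g \<bullet> x + c) f \<alpha>)"
    and "continuous_on XX (bracket (\<lambda>x. g \<bullet> x + c) f \<alpha>)"
proof -
  have \<alpha>': "\<alpha> > 0" "f /\<^sub>R \<alpha> \<in> F" using \<alpha> by (auto simp: mem_scales)
  have M: "concave_on M (\<Phi> (f /\<^sub>R \<alpha>))"
    using regular \<alpha>' by (simp add: regular_data_def)
  show "concave_on XX (bracket (\<lambda>x. g \<bullet> x + c) f \<alpha>)"
    unfolding concave_on_iff
  proof (intro conjI ballI allI impI)
    fix x y and s t :: real
    assume xy: "x \<in> XX" "y \<in> XX" and st: "0 \<le> s" "0 \<le> t" "s + t = 1"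
    let ?\<Phi> = "\<lambda>x. \<Phi> (f /\<^sub>R \<alpha>) (A x)"
    have "s * ?\<Phi> x + t * ?\<Phi> y \<le> ?\<Phi> (s *\<^sub>R x + t *\<^sub>R y)"
    proof -
      have "A x \<in> M" "A y \<in> M" using xy A(2) by auto
      then show ?thesis unfolding A_combination[OF st(3)] using M st by (simp add: concave_on_iff)
    qed
    then have "\<alpha> * (s * ?\<Phi> x + t * ?\<Phi> y) \<le> \<alpha> * ?\<Phi> (s *\<^sub>R x + t *\<^sub>R y)"
      using \<alpha>' by (intro mult_left_mono) auto
    moreover define l where "l = \<alpha> * ln (2 / \<epsilon>)"
    moreover have "c = s * c + t * c" "l = s * l + t * l"
      using st by (metis distrib_right mult_1)+
    ultimately show "s * bracket (\<lambda>x. g \<bullet> x + c) f \<alpha> x + t * bracket (\<lambda>x. g \<bullet> x + c) f \<alpha> y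
        \<le> bracket (\<lambda>x. g \<bullet> x + c) f \<alpha> (s *\<^sub>R x + t *\<^sub>R y)"
      unfolding bracket_def l_def[symmetric] by (simp add: inner_add_right algebra_simps)
  qed (fact XX)
  have "continuous_on XX (\<lambda>x. (\<lambda>(h, \<mu>). \<Phi> h \<mu>) (f /\<^sub>R \<alpha>, A x))"
    by (rule continuous_on_compose2[where t = "F \<times> M"])
      (use regular \<alpha>' A(2) in \<open>auto simp: regular_data_def intro!: continuous_intros continuous_on_A\<close>)
  then show "continuous_on XX (bracket (\<lambda>x. g \<bullet> x + c) f \<alpha>)"
    unfolding bracket_def by (auto intro!: continuous_intros)
qed

lemma upper_eq: "upper G f = (INF \<alpha>\<in>scales f. SUP x\<in>XX. ereal (bracket G f \<alpha> x))"
proof -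
  have "Psi_plus \<Phi> XX A G f \<alpha> + ereal r = (SUP x\<in>XX. ereal (\<alpha> * \<Phi> (f /\<^sub>R \<alpha>) (A x) - G x + r))" for \<alpha> r
    unfolding Psi_plus_def by (subst SUP_ereal_add_left[symmetric]) (auto simp: XX)
  then show ?thesis by (simp add: Psi_plus_hat_def scales_def bracket_def)
qed

lemma upper_le:
  "\<lbrakk>\<alpha> \<in> scales f; \<And>x. x \<in> XX \<Longrightarrow> bracket G f \<alpha> x \<le> y\<rbrakk> \<Longrightarrow> upper G f \<le> ereal y"
  unfolding upper_eq by (rule INF_lower2, assumption) (auto intro: SUP_least)

lemma upper_less_obtain_scale:
  assumes "upper G f < ereal y"
  obtains \<alpha> where "\<alpha> \<in> scales f" "\<And>x. x \<in> XX \<Longrightarrow> bracket G f \<alpha> x \<le> y"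
proof -
  obtain \<alpha> where \<alpha>: "\<alpha> \<in> scales f" "(SUP x\<in>XX. ereal (bracket G f \<alpha> x)) < ereal y"
    using assms by (auto simp: upper_eq INF_less_iff)
  have "bracket G f \<alpha> x \<le> y" if "x \<in> XX" for x
    using SUP_upper[OF that, of "\<lambda>x. ereal (bracket G f \<alpha> x)"] \<alpha>(2)
    by (metis ereal_less_eq(3) le_less_trans less_imp_le)
  then show ?thesis using that \<alpha>(1) by blast
qed

lemma upper_is_max:
  "is_max_over (upper (\<lambda>x. g \<bullet> x + c) f)
     (\<lambda>x. INF \<alpha>\<in>scales f. ereal (bracket (\<lambda>x. g \<bullet> x + c) f \<alpha> x)) XX"
  unfolding upper_eq
proof (rule compact_minimax)
  have comb: "s *\<^sub>R f + t *\<^sub>R f = f" if "s + t = 1" for s t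
    using that by (metis scaleR_add_left scaleR_one)
  obtain x where x: "x \<in> XX" using XX by blast
  show conv: "convex (scales f)"
    unfolding convex_def
    using bracket_jointly_convex(1)[OF x, of _ f _ f] comb by (metis real_scaleR_def)
  show "convex_on (scales f) (\<lambda>\<alpha>. bracket (\<lambda>x. g \<bullet> x + c) f \<alpha> x)" if "x \<in> XX" for x
    unfolding convex_on_def
  proof (intro conjI ballI allI impI)
    fix \<alpha> \<beta> s t :: real
    assume "\<alpha> \<in> scales f" "\<beta> \<in> scales f" "0 \<le> s" "0 \<le> t" and st: "s + t = 1"
    then show "bracket (\<lambda>x. g \<bullet> x + c) f (s *\<^sub>R \<alpha> + t *\<^sub>R \<beta>) x
      \<le> s * bracket (\<lambda>x. g \<bullet> x + c) f \<alpha> x + t * bracket (\<lambda>x. g \<bullet> x + c) f \<beta> x"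
      using bracket_jointly_convex(2)[OF that, of \<alpha> f \<beta> f s t "\<lambda>x. g \<bullet> x + c"]
      by (simp add: comb[OF st])
  qed (fact conv)
qed (use bracket_concave_continuous XX in auto)

text \<open>
  The source of all lower bounds: at the midpoint of \<open>f\<close> and \<open>-f\<close> the perspective is a positive
  multiple of \<open>\<Phi>(0; A x) \<ge> 0\<close>, the logarithmic term is positive since \<open>\<epsilon> < 1\<close>, and the two
  contributions of \<open>G\<close> cancel.
\<close>
lemma bracket_add_opposite_nonneg:
  assumes x: "x \<in> XX" and "\<alpha> \<in> scales f" "\<beta> \<in> scales (- f)"
  shows "0 \<le> bracket G f \<alpha> x + bracket (\<lambda>x. - G x) (- f) \<beta> x"
proof -
  \<comment> \<open>Since the contributions of \<open>G\<close> cancel in the sum, the zero function can take its place.\<close>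
  let ?z = "\<lambda>x. 0 :: real" and ?m = "1/2 * \<alpha> + 1/2 * \<beta>"
  have "?m \<ge> 0" using assms(2,3) by (simp add: mem_scales del: scales_uminus)
  moreover have "\<Phi> 0 (A x) \<ge> 0" using \<Phi>_0 A(2) x by blast
  ultimately have "0 \<le> ?m * \<Phi> 0 (A x) + ?m * ln (2 / \<epsilon>)"
    using eps mult_nonneg_nonneg[of ?m "\<Phi> 0 (A x)"] mult_nonneg_nonneg[of ?m "ln (2 / \<epsilon>)"] by simp
  also have "\<dots> = bracket ?z ((1/2) *\<^sub>R f + (1/2) *\<^sub>R (- f)) ?m x"
    by (simp add: bracket_def)
  also have "\<dots> \<le> 1/2 * bracket ?z f \<alpha> x + 1/2 * bracket ?z (- f) \<beta> x"
    by (rule bracket_jointly_convex(2)) (use assms in auto)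
  finally have "0 \<le> bracket ?z f \<alpha> x + bracket ?z (- f) \<beta> x" by linarith
  then show ?thesis by (simp add: bracket_def)
qed

lemma upper_finite: "\<bar>upper (\<lambda>x. g \<bullet> x + c) f\<bar> \<noteq> \<infinity>"
proof -
  let ?G = "\<lambda>x. g \<bullet> x + c"
  obtain \<alpha> where \<alpha>: "\<alpha> \<in> scales f" using scales_nonempty by blast
  obtain z where "\<And>x. x \<in> XX \<Longrightarrow> bracket ?G f \<alpha> x \<le> bracket ?G f \<alpha> z"
    using continuous_attains_sup[OF XX(3,1) bracket_concave_continuous(2)[OF \<alpha>]] by blast
  then have "upper ?G f \<le> ereal (bracket ?G f \<alpha> z)" by (rule upper_le[OF \<alpha>])
  moreover obtain x where x: "x \<in> XX" using XX by blast
  obtain \<beta> where \<beta>: "\<beta> \<in> scales (- f)" using scales_nonempty by blast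
  have "ereal (- bracket (\<lambda>x. - ?G x) (- f) \<beta> x) \<le> upper ?G f"
    unfolding upper_eq
  proof (intro INF_greatest SUP_upper2[OF x])
    fix \<gamma> assume "\<gamma> \<in> scales f"
    then show "ereal (- bracket (\<lambda>x. - ?G x) (- f) \<beta> x) \<le> ereal (bracket ?G f \<gamma> x)"
      using bracket_add_opposite_nonneg[OF x _ \<beta>, of \<gamma> ?G] by simp
  qed
  ultimately show ?thesis by (cases "upper ?G f") auto
qed

lemma upper_real: "ereal (real_of_ereal (upper (\<lambda>x. g \<bullet> x + c) f)) = upper (\<lambda>x. g \<bullet> x + c) f"
  using upper_finite by (simp add: ereal_real)

text \<open>
  Scales that are optimal up to \<open>\<eta>\<close> for \<open>u\<close> and \<open>v\<close> combine to a scale for \<open>s u + t v\<close>, by joint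
  convexity of the bracket; near-optimality is used because the infima need not be attained.
\<close>
lemma upper_convex: "convex_on UNIV (\<lambda>f. real_of_ereal (upper (\<lambda>x. g \<bullet> x + c) f))"
  (is "convex_on UNIV ?U")
  unfolding convex_on_def
proof (intro conjI ballI allI impI)
  let ?G = "\<lambda>x. g \<bullet> x + c"
  fix u v :: 'f and s t :: real
  assume st: "0 \<le> s" "0 \<le> t" "s + t = 1"
  show "?U (s *\<^sub>R u + t *\<^sub>R v) \<le> s * ?U u + t * ?U v"
  proof (rule field_le_epsilon)
    fix \<eta> :: real assume "\<eta> > 0"
    then have "upper ?G f < ereal (?U f + \<eta>)" for f
      by (subst upper_real[symmetric]) simp
    then obtain \<alpha> \<beta> where \<alpha>: "\<alpha> \<in> scales u" "\<And>x. x \<in> XX \<Longrightarrow> bracket ?G u \<alpha> x \<le> ?U u + \<eta>"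
      and \<beta>: "\<beta> \<in> scales v" "\<And>x. x \<in> XX \<Longrightarrow> bracket ?G v \<beta> x \<le> ?U v + \<eta>"
      by (metis upper_less_obtain_scale)
    have "s * \<alpha> + t * \<beta> \<in> scales (s *\<^sub>R u + t *\<^sub>R v)"
      using XX(1) bracket_jointly_convex(1)[OF _ \<alpha>(1) \<beta>(1) st] by blast
    then have "upper ?G (s *\<^sub>R u + t *\<^sub>R v) \<le> ereal (s * ?U u + t * ?U v + \<eta>)"
    proof (rule upper_le)
      fix x assume x: "x \<in> XX"
      have "bracket ?G (s *\<^sub>R u + t *\<^sub>R v) (s * \<alpha> + t * \<beta>) x
        \<le> s * bracket ?G u \<alpha> x + t * bracket ?G v \<beta> x"
        by (rule bracket_jointly_convex(2)[OF x \<alpha>(1) \<beta>(1) st])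
      also have "\<dots> \<le> s * (?U u + \<eta>) + t * (?U v + \<eta>)"
        using \<alpha>(2)[OF x] \<beta>(2)[OF x] st by (intro add_mono mult_left_mono) auto
      also have "\<dots> = s * ?U u + t * ?U v + (s + t) * \<eta>" by (simp add: algebra_simps)
      finally show "bracket ?G (s *\<^sub>R u + t *\<^sub>R v) (s * \<alpha> + t * \<beta>) x \<le> s * ?U u + t * ?U v + \<eta>"
        using st by simp
    qed
    then show "?U (s *\<^sub>R u + t *\<^sub>R v) \<le> s * ?U u + t * ?U v + \<eta>"
      by (subst (asm) upper_real[symmetric]) simp
  qed
qed simp

lemma upper_add_opposite_nonneg:
  assumes "upper G f \<le> ereal y" "upper (\<lambda>x. - G x) (- f) \<le> ereal z"
  shows "0 \<le> y + z"
proof (rule field_le_epsilon)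
  fix \<eta> :: real assume \<eta>: "\<eta> > 0"
  have "upper G f < ereal (y + \<eta> / 2)" "upper (\<lambda>x. - G x) (- f) < ereal (z + \<eta> / 2)"
    using assms \<eta> by (auto elim!: le_less_trans)
  then obtain \<alpha> \<beta> where \<alpha>: "\<alpha> \<in> scales f" "\<And>x. x \<in> XX \<Longrightarrow> bracket G f \<alpha> x \<le> y + \<eta> / 2"
    and \<beta>: "\<beta> \<in> scales (- f)" "\<And>x. x \<in> XX \<Longrightarrow> bracket (\<lambda>x. - G x) (- f) \<beta> x \<le> z + \<eta> / 2"
    by (metis upper_less_obtain_scale)
  obtain x where x: "x \<in> XX" using XX by blast
  show "0 \<le> y + z + \<eta>"
    using bracket_add_opposite_nonneg[OF x \<alpha>(1) \<beta>(1), of G] \<alpha>(2)[OF x] \<beta>(2)[OF x] by simp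
qed

text \<open>
  With \<open>h = f / \<alpha>\<close>, a bracket of at most \<open>r + \<eta>\<close> says exactly that
  \<open>\<Phi>(h; A x) + ln (2 / \<epsilon>) \<le> (r + G x + \<eta>) / \<alpha>\<close>. As \<open>\<Phi>(h; A x)\<close> bounds the log-moment
  of an associated distribution at \<open>h\<close>, this is the threshold condition of Chernoff's bound at the
  level \<open>\<epsilon> / 2\<close>.
\<close>
lemma upper_tail_bound:
  assumes x: "x \<in> XX" and assoc: "associated F \<Phi> A x P"
    and le: "upper G f \<le> ereal r"
  shows "\<P>(\<omega> in P. f \<bullet> \<omega> > r + G x) \<le> \<epsilon> / 2"
proof -
  have P: "prob_space P" and [measurable_cong]: "sets P = sets borel"
    using assoc by (auto simp: associated_def)
  interpret prob_space P by (fact P)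
  show ?thesis
  proof (rule prob_greater_le_of_slack)
    fix \<eta> :: real assume "\<eta> > 0"
    then have "upper G f < ereal (r + \<eta>)" using le by (auto elim!: le_less_trans)
    then obtain \<alpha> where \<alpha>: "\<alpha> \<in> scales f" "bracket G f \<alpha> x \<le> r + \<eta>"
      using upper_less_obtain_scale x by metis
    then have pos: "\<alpha> > 0" and F: "f /\<^sub>R \<alpha> \<in> F" by (auto simp: mem_scales)
    have "\<alpha> * (\<Phi> (f /\<^sub>R \<alpha>) (A x) + ln (2 / \<epsilon>)) \<le> r + G x + \<eta>"
      using \<alpha>(2) by (simp add: bracket_def algebra_simps)
    then have "\<Phi> (f /\<^sub>R \<alpha>) (A x) + ln (2 / \<epsilon>) \<le> (r + G x + \<eta>) / \<alpha>"
      using pos by (simp add: field_simps)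
    moreover have "integrable P (\<lambda>\<omega>. exp ((f /\<^sub>R \<alpha>) \<bullet> \<omega>))"
      "ln (LINT \<omega>|P. exp ((f /\<^sub>R \<alpha>) \<bullet> \<omega>)) \<le> \<Phi> (f /\<^sub>R \<alpha>) (A x)"
      using assoc F unfolding associated_def by blast+
    ultimately have "\<P>(\<omega> in P. (f /\<^sub>R \<alpha>) \<bullet> \<omega> \<ge> (r + G x + \<eta>) / \<alpha>) \<le> \<epsilon> / 2"
      using eps by (intro exp_moment_tail_bound[OF P \<open>sets P = sets borel\<close>]) auto
    moreover have "(f /\<^sub>R \<alpha>) \<bullet> \<omega> \<ge> (r + G x + \<eta>) / \<alpha> \<longleftrightarrow> f \<bullet> \<omega> \<ge> r + G x + \<eta>" for \<omega>
      using pos by (simp add: inner_commute[of _ \<omega>] divide_inverse mult.commute[of _ "inverse \<alpha>"])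
    ultimately show "\<P>(\<omega> in P. f \<bullet> \<omega> \<ge> r + G x + \<eta>) \<le> \<epsilon> / 2" by simp
  qed measurable
qed

lemma two_sided_tail_bound:
  assumes x: "x \<in> XX" and assoc: "associated F \<Phi> A x P"
    and le: "upper G f \<le> ereal (\<rho> - \<kappa>)" "upper (\<lambda>x. - G x) (- f) \<le> ereal (\<rho> + \<kappa>)"
  shows "\<P>(\<omega> in P. \<bar>(f \<bullet> \<omega> + \<kappa>) - G x\<bar> > \<rho>) \<le> \<epsilon>"
proof -
  have P: "prob_space P" and [measurable_cong]: "sets P = sets borel"
    using assoc by (auto simp: associated_def)
  interpret prob_space P by (fact P)
  let ?E = "{\<omega> \<in> space P. f \<bullet> \<omega> > \<rho> - \<kappa> + G x}"
  let ?E' = "{\<omega> \<in> space P. (- f) \<bullet> \<omega> > \<rho> + \<kappa> + - G x}"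
  have "{\<omega> \<in> space P. \<bar>(f \<bullet> \<omega> + \<kappa>) - G x\<bar> > \<rho>} = ?E \<union> ?E'"
    by (auto simp: abs_if)
  then have "\<P>(\<omega> in P. \<bar>(f \<bullet> \<omega> + \<kappa>) - G x\<bar> > \<rho>) \<le> prob ?E + prob ?E'"
    using measure_Un_le[of ?E P ?E'] by simp
  also have "\<dots> \<le> \<epsilon> / 2 + \<epsilon> / 2"
    by (intro add_mono upper_tail_bound[OF x assoc le(1)] upper_tail_bound[OF x assoc le(2)])
  finally show ?thesis by simp
qed

lemma Psi_minus_hat_eq: "Psi_minus_hat F \<Phi> XX A G \<epsilon> f = upper (\<lambda>x. - G x) (- f)"
  using scales_uminus[of f]
  by (simp add: Psi_minus_hat_def Psi_plus_hat_def Psi_minus_def Psi_plus_def scales_def)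

end

section \<open>The affine estimate\<close>

theorem proposition3p1:
  fixes F :: "'f::euclidean_space set"
    and M :: "'m::euclidean_space set"
    and \<Phi> :: "'f \<Rightarrow> 'm \<Rightarrow> real"
    and X XX :: "'x::euclidean_space set"
    and A :: "'x \<Rightarrow> 'm"
    and g :: 'x and c \<epsilon> :: real
  defines "G \<equiv> (\<lambda>x. g \<bullet> x + c)"
  defines "\<Psi>p \<equiv> Psi_plus_hat F \<Phi> XX A G \<epsilon>"
    and "\<Psi>m \<equiv> Psi_minus_hat F \<Phi> XX A G \<epsilon>"
    and "\<Psi> \<equiv> Psi_hat F \<Phi> XX A G \<epsilon>"
  defines "risk \<equiv> eps_risk F \<Phi> X A G \<epsilon>"
    and "Opt \<equiv> (INF f. \<Psi> f)"
    and "kbar \<equiv> (\<lambda>f. real_of_ereal ((\<Psi>m f - \<Psi>p f) / 2))"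
  assumes "regular_data F M \<Phi>"
    and "X \<noteq> {}" and "X \<subseteq> XX" and "convex XX" and "compact XX"
    and "affine_mapping A" and "A ` XX \<subseteq> M"
    and "0 < \<epsilon>" and "\<epsilon> < 1"
    and "\<forall>\<mu>\<in>M. \<Phi> 0 \<mu> \<ge> 0"
  shows
    "(\<forall>f. is_max_over (\<Psi>p f)
            (\<lambda>x. INF \<alpha>\<in>{\<alpha>. \<alpha> > 0 \<and> (f, \<alpha>) \<in> F_plus F}.
                   ereal (\<alpha> * \<Phi> (f /\<^sub>R \<alpha>) (A x) - G x + \<alpha> * ln (2 / \<epsilon>))) XX) \<and>
     (\<forall>f. is_max_over (\<Psi>m f)
            (\<lambda>x. INF \<alpha>\<in>{\<alpha>. \<alpha> > 0 \<and> (f, \<alpha>) \<in> F_plus F}.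
                   ereal (\<alpha> * \<Phi> ((- f) /\<^sub>R \<alpha>) (A x) + G x + \<alpha> * ln (2 / \<epsilon>))) XX) \<and>
     (\<forall>f. \<bar>\<Psi>p f\<bar> \<noteq> \<infinity> \<and> \<bar>\<Psi>m f\<bar> \<noteq> \<infinity>) \<and>
     convex_on UNIV (\<lambda>f. real_of_ereal (\<Psi>p f)) \<and>
     convex_on UNIV (\<lambda>f. real_of_ereal (\<Psi>m f)) \<and>
     (\<forall>f \<kappa> \<rho>. \<Psi>p f \<le> ereal (\<rho> - \<kappa>) \<and> \<Psi>m f \<le> ereal (\<rho> + \<kappa>) \<longrightarrow>
        (\<lambda>\<omega>. f \<bullet> \<omega> + \<kappa>) \<in> borel_measurable borel \<and>
        risk (\<lambda>\<omega>. f \<bullet> \<omega> + \<kappa>) \<le> ereal \<rho> \<and>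
        (\<forall>x\<in>X. \<forall>P. associated F \<Phi> A x P \<longrightarrow>
           \<P>(\<omega> in P. \<bar>(f \<bullet> \<omega> + \<kappa>) - G x\<bar> > \<rho>) \<le> \<epsilon>)) \<and>
     (\<forall>f. \<Psi>p f \<le> ereal (real_of_ereal (\<Psi> f) - kbar f) \<and>
          \<Psi>m f \<le> ereal (real_of_ereal (\<Psi> f) + kbar f)) \<and>
     (\<forall>\<delta>>0. \<exists>f. \<Psi> f < Opt + ereal \<delta> \<and> risk (\<lambda>\<omega>. f \<bullet> \<omega> + kbar f) \<le> \<Psi> f) \<and>
     ((\<exists>f. \<forall>f'. \<Psi> f \<le> \<Psi> f') \<longrightarrow>
        (\<exists>f. \<Psi> f = Opt \<and> risk (\<lambda>\<omega>. f \<bullet> \<omega> + kbar f) \<le> \<Psi> f))"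
proof -
  have "XX \<noteq> {}" using \<open>X \<noteq> {}\<close> \<open>X \<subseteq> XX\<close> by blast
  then interpret estimation_data F M \<Phi> XX A \<epsilon>
    using assms by unfold_locales auto
  have negG: "(\<lambda>x. - G x) = (\<lambda>x. (- g) \<bullet> x + (- c))" by (simp add: G_def)
  have p: "\<Psi>p f = upper (\<lambda>x. g \<bullet> x + c) f" for f by (simp add: \<Psi>p_def G_def)
  have m: "\<Psi>m f = upper (\<lambda>x. (- g) \<bullet> x + (- c)) (- f)" for f
    by (simp only: \<Psi>m_def Psi_minus_hat_eq negG)
  have max_p: "is_max_over (\<Psi>p f)
      (\<lambda>x. INF \<alpha>\<in>{\<alpha>. \<alpha> > 0 \<and> (f, \<alpha>) \<in> F_plus F}.
             ereal (\<alpha> * \<Phi> (f /\<^sub>R \<alpha>) (A x) - G x + \<alpha> * ln (2 / \<epsilon>))) XX" for f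
    using upper_is_max[of g c f] by (simp add: p scales_def bracket_def G_def)
  have max_m: "is_max_over (\<Psi>m f)
      (\<lambda>x. INF \<alpha>\<in>{\<alpha>. \<alpha> > 0 \<and> (f, \<alpha>) \<in> F_plus F}.
             ereal (\<alpha> * \<Phi> ((- f) /\<^sub>R \<alpha>) (A x) + G x + \<alpha> * ln (2 / \<epsilon>))) XX" for f
  proof -
    have "is_max_over (\<Psi>m f)
      (\<lambda>x. INF \<alpha>\<in>scales f. ereal (bracket (\<lambda>x. - G x) (- f) \<alpha> x)) XX"
      using upper_is_max[of "- g" "- c" "- f"] unfolding m negG scales_uminus .
    then show ?thesis by (simp add: scales_def bracket_def)
  qed
  define p' m' where "p' f = real_of_ereal (\<Psi>p f)" and "m' f = real_of_ereal (\<Psi>m f)" for f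
  have p': "\<Psi>p f = ereal (p' f)" and m': "\<Psi>m f = ereal (m' f)" for f
    unfolding p'_def m'_def p m upper_real by simp_all
  have \<Psi>: "\<Psi> f = ereal ((p' f + m' f) / 2)" for f
    using p'[of f] m'[of f] by (simp add: \<Psi>_def Psi_hat_def \<Psi>p_def \<Psi>m_def numeral_eq_ereal)
  have kbar: "kbar f = (m' f - p' f) / 2" for f
    by (simp add: kbar_def p' m' numeral_eq_ereal)
  have conv_p: "convex_on UNIV (\<lambda>f. real_of_ereal (\<Psi>p f))"
    unfolding p by (rule upper_convex)
  have conv_m: "convex_on UNIV (\<lambda>f. real_of_ereal (\<Psi>m f))"
  proof -
    have "convex_on UNIV (\<lambda>f. real_of_ereal (upper (\<lambda>x. (- g) \<bullet> x + (- c)) f))"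
      by (rule upper_convex)
    then show ?thesis unfolding m convex_on_def by (auto simp: minus_add_distrib simp flip: scaleR_minus_right)
  qed
  have tail: "\<P>(\<omega> in P. \<bar>(f \<bullet> \<omega> + \<kappa>) - G x\<bar> > \<rho>) \<le> \<epsilon>"
    if "\<Psi>p f \<le> ereal (\<rho> - \<kappa>)" "\<Psi>m f \<le> ereal (\<rho> + \<kappa>)" "x \<in> X" "associated F \<Phi> A x P"
    for f \<kappa> \<rho> x P
    using that \<open>X \<subseteq> XX\<close>
    by (intro two_sided_tail_bound) (auto simp: \<Psi>p_def \<Psi>m_def Psi_minus_hat_eq)
  have risk: "risk (\<lambda>\<omega>. f \<bullet> \<omega> + \<kappa>) \<le> ereal \<rho>"
    if "\<Psi>p f \<le> ereal (\<rho> - \<kappa>)" "\<Psi>m f \<le> ereal (\<rho> + \<kappa>)" for f \<kappa> \<rho>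
    unfolding risk_def eps_risk_def using tail[OF that] by (intro INF_lower) auto
  have feasible: "\<Psi>p f \<le> ereal (real_of_ereal (\<Psi> f) - kbar f)"
    "\<Psi>m f \<le> ereal (real_of_ereal (\<Psi> f) + kbar f)" for f
    by (simp_all add: p' m' \<Psi> kbar field_simps)
  have risk_\<Psi>: "risk (\<lambda>\<omega>. f \<bullet> \<omega> + kbar f) \<le> \<Psi> f" for f
    using risk[OF feasible[of f]] by (simp add: \<Psi>)
  have "0 \<le> \<Psi> f" for f
    using upper_add_opposite_nonneg[of G f "p' f" "m' f"] p'[of f] m'[of f]
    by (simp add: \<Psi> \<Psi>p_def \<Psi>m_def Psi_minus_hat_eq)
  \<comment> \<open>A finite \<open>Opt\<close> is needed for \<open>Opt < Opt + \<delta>\<close>, hence for near-optimal \<open>f\<close> to exist.\<close>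
  then have "0 \<le> Opt" unfolding Opt_def by (intro INF_greatest)
  moreover have "Opt \<le> \<Psi> 0" unfolding Opt_def by (rule INF_lower) simp
  ultimately obtain o' where o': "Opt = ereal o'" by (cases Opt) (auto simp: \<Psi>)
  have near: "\<exists>f. \<Psi> f < Opt + ereal \<delta> \<and> risk (\<lambda>\<omega>. f \<bullet> \<omega> + kbar f) \<le> \<Psi> f" if "\<delta> > 0" for \<delta>
  proof -
    have "Opt < Opt + ereal \<delta>" using that by (simp add: o')
    then obtain f where "\<Psi> f < Opt + ereal \<delta>"
      by (subst (asm) (1) Opt_def) (auto simp: INF_less_iff)
    then show ?thesis using risk_\<Psi> by blast
  qed
  have attained: "\<exists>f. \<Psi> f = Opt \<and> risk (\<lambda>\<omega>. f \<bullet> \<omega> + kbar f) \<le> \<Psi> f" if "\<forall>f'. \<Psi> f \<le> \<Psi> f'" for f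
  proof -
    have "\<Psi> f = Opt"
      unfolding Opt_def using that by (intro antisym INF_greatest INF_lower) auto
    then show ?thesis using risk_\<Psi> by blast
  qed
  show ?thesis
  proof (intro conjI)
    show "\<forall>f. \<bar>\<Psi>p f\<bar> \<noteq> \<infinity> \<and> \<bar>\<Psi>m f\<bar> \<noteq> \<infinity>" by (simp add: p' m')
    show "\<forall>f \<kappa> \<rho>. \<Psi>p f \<le> ereal (\<rho> - \<kappa>) \<and> \<Psi>m f \<le> ereal (\<rho> + \<kappa>) \<longrightarrow>
        (\<lambda>\<omega>. f \<bullet> \<omega> + \<kappa>) \<in> borel_measurable borel \<and>
        risk (\<lambda>\<omega>. f \<bullet> \<omega> + \<kappa>) \<le> ereal \<rho> \<and>
        (\<forall>x\<in>X. \<forall>P. associated F \<Phi> A x P \<longrightarrow>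
           \<P>(\<omega> in P. \<bar>(f \<bullet> \<omega> + \<kappa>) - G x\<bar> > \<rho>) \<le> \<epsilon>)"
      using tail risk by (intro allI impI conjI ballI) (auto intro!: borel_measurable_continuous_onI continuous_intros)
  qed (use max_p max_m conv_p conv_m feasible near attained in blast)+
qed

end
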